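(* Let $X_1,X_2,\dots$ be any sequence of (possibly correlated) random variables with $\mathrm{Var}(X_i)<+\infty$ for $i=1,2,\dots$. If $$\frac1n\sum_{i=1}^n\mathrm{Var}(X_i)\to 0\quad(n\to+\infty),$$ then for any $\varepsilon>0$, $$\lim_{n\to\infty}P\Big(\Big|\frac1n\sum_{i=1}^nX_i-\frac1n\sum_{i=1}^nE X_i\Big|<\varepsilon\Big)=1.$$
   Context: Random variables are real-valued, defined on a common probability space with probability $P$, with finite expectation and variance. "Correlated" only means that no independence or uncorrelatedness is assumed. $E$ and $\mathrm{Var}$ denote expectation and variance. *)

theory Defs
  imports "HOL-Probability.Probability"
begin

end

theory Submission
  imports Defs
begin

text \<open>By the Cauchy-Schwarz inequality, the square of the average of the centred variables is at most
  the average of their squares. The expectation of the latter is the average of the variances, so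
  no covariances enter and Markov's inequality suffices.\<close>

lemma (in prob_space) prob_average_deviation_ge:
  fixes X :: "'i \<Rightarrow> 'a \<Rightarrow> real"
  assumes int: "\<And>i. i \<in> I \<Longrightarrow> integrable M (\<lambda>x. (X i x - expectation (X i))\<^sup>2)"
    and "\<epsilon> > 0"
  shows "prob {x \<in> space M. \<epsilon> \<le> \<bar>(\<Sum>i\<in>I. X i x) / card I - (\<Sum>i\<in>I. expectation (X i)) / card I\<bar>}
    \<le> (\<Sum>i\<in>I. variance (X i)) / card I / \<epsilon>\<^sup>2"
proof (cases "card I = 0")
  \<comment> \<open>Covers both an empty and an infinite \<open>I\<close>. Division by zero yields
    0, so the deviation is 0, the event is empty because \<open>\<epsilon> > 0\<close>, and both
    sides vanish.\<close>
  case True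
  then show ?thesis using \<open>\<epsilon> > 0\<close> by simp
next
  case False
  define Z where "Z x = (\<Sum>i\<in>I. (X i x - expectation (X i))\<^sup>2) / card I" for x
  have Z_int: "integrable M Z"
    unfolding Z_def using int by auto
  have Z_nonneg: "Z x \<ge> 0" for x
    unfolding Z_def by (intro divide_nonneg_nonneg sum_nonneg) auto
  have le_Z: "\<epsilon>\<^sup>2 \<le> Z x"
    if "\<epsilon> \<le> \<bar>(\<Sum>i\<in>I. X i x) / card I - (\<Sum>i\<in>I. expectation (X i)) / card I\<bar>" for x
  proof -
    let ?S = "\<Sum>i\<in>I. X i x - expectation (X i)"
    have "\<epsilon> \<le> \<bar>?S / card I\<bar>"
      using that by (simp add: sum_subtractf diff_divide_distrib)
    then have "\<epsilon>\<^sup>2 \<le> (?S / card I)\<^sup>2"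
      using \<open>\<epsilon> > 0\<close> by (metis abs_le_square_iff abs_of_pos)
    \<comment> \<open>Splitting the denominator prepares the next two steps: Cauchy-Schwarz against
      the constant 1 bounds \<open>?S\<^sup>2\<close> at the cost of a factor \<open>card I\<close>,
      which cancels one of the divisions and leaves the average \<open>Z x\<close>.\<close>
    also have "\<dots> = ?S\<^sup>2 / card I / card I"
      by (simp add: power2_eq_square)
    also have "\<dots> \<le> (\<Sum>i\<in>I. (X i x - expectation (X i))\<^sup>2) * card I / card I / card I"
      by (intro divide_right_mono sum_squared_le_sum_of_squares) auto
    also have "\<dots> = Z x"
      using False by (simp add: Z_def)
    finally show ?thesis .
  qed
  \<comment> \<open>Monotonicity of the measure asks for measurability of the larger event, which
    the integrability of \<open>Z\<close> supplies.\<close>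
  have "prob {x \<in> space M. \<epsilon> \<le> \<bar>(\<Sum>i\<in>I. X i x) / card I - (\<Sum>i\<in>I. expectation (X i)) / card I\<bar>}
      \<le> prob {x \<in> space M. \<epsilon>\<^sup>2 \<le> Z x}"
    using le_Z Z_int by (intro finite_measure_mono) auto
  also have "\<dots> \<le> expectation Z / \<epsilon>\<^sup>2"
    using Z_int Z_nonneg \<open>\<epsilon> > 0\<close>
    by (intro integral_Markov_inequality_measure[where A = "{}"]) auto
  also have "expectation Z = (\<Sum>i\<in>I. variance (X i)) / card I"
    unfolding Z_def using int by (simp add: Bochner_Integration.integral_sum)
  finally show ?thesis .
qed

theorem theorem7:
  fixes M :: "'a measure" and X :: "nat \<Rightarrow> 'a \<Rightarrow> real"
  assumes "prob_space M"
    and "\<And>i. i \<ge> 1 \<Longrightarrow> X i \<in> borel_measurable M"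
    and "\<And>i. i \<ge> 1 \<Longrightarrow> integrable M (X i)"
    and "\<And>i. i \<ge> 1 \<Longrightarrow> integrable M (\<lambda>x. (X i x - prob_space.expectation M (X i))\<^sup>2)"
    and "(\<lambda>n. (1 / real n) * (\<Sum>i=1..n. prob_space.variance M (X i))) \<longlonglongrightarrow> 0"
  shows "\<forall>\<epsilon>>0. (\<lambda>n. \<P>(x in M. \<bar>(1 / real n) * (\<Sum>i=1..n. X i x)
            - (1 / real n) * (\<Sum>i=1..n. prob_space.expectation M (X i))\<bar> < \<epsilon>)) \<longlonglongrightarrow> 1"
proof (intro allI impI)
  fix \<epsilon> :: real
  assume "\<epsilon> > 0"
  interpret prob_space M by fact
  let ?V = "\<lambda>n. (1 / real n) * (\<Sum>i=1..n. variance (X i))"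
  let ?D = "\<lambda>n x. \<bar>(1 / real n) * (\<Sum>i=1..n. X i x) - (1 / real n) * (\<Sum>i=1..n. expectation (X i))\<bar>"
  \<comment> \<open>Passing to the complement turns the upper bound on large deviations into a lower
    bound. It holds at \<open>n = 0\<close> too: both averages are then 0 and the bound reads
    \<open>1 \<le> 1\<close>.\<close>
  have lower: "1 - ?V n / \<epsilon>\<^sup>2 \<le> \<P>(x in M. ?D n x < \<epsilon>)" for n
  proof -
    \<comment> \<open>The complement rule below needs the event to be measurable.\<close>
    have [measurable]: "(\<lambda>x. \<Sum>i=1..n. X i x) \<in> borel_measurable M"
      using assms(2) by (intro borel_measurable_sum) auto
    have "\<P>(x in M. ?D n x < \<epsilon>) = 1 - \<P>(x in M. \<not> ?D n x < \<epsilon>)"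
      by (subst prob_neg) measurable
    moreover have "\<P>(x in M. \<not> ?D n x < \<epsilon>) \<le> ?V n / \<epsilon>\<^sup>2"
      using prob_average_deviation_ge[of "{1..n}" X \<epsilon>] assms(4) \<open>\<epsilon> > 0\<close> by (simp add: not_less)
    ultimately show ?thesis by linarith
  qed
  have "(\<lambda>n. 1 - ?V n / \<epsilon>\<^sup>2) \<longlonglongrightarrow> 1 - 0 / \<epsilon>\<^sup>2"
    using \<open>\<epsilon> > 0\<close> by (intro tendsto_intros assms(5)) simp
  then have "(\<lambda>n. 1 - ?V n / \<epsilon>\<^sup>2) \<longlonglongrightarrow> 1" by simp
  \<comment> \<open>Squeezed between the lower bound and the constant 1, which bounds every
    probability.\<close>
  then show "(\<lambda>n. \<P>(x in M. ?D n x < \<epsilon>)) \<longlonglongrightarrow> 1"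
    by (rule tendsto_sandwich[rotated 2, OF _ tendsto_const]) (use lower in auto)
qed

end
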